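(* Let $U$ and $W$ be $\mathbb{R}$-linear spaces, let $\pi : U \to W$ be an $\mathbb{R}$-linear map, and let $G$ be a group acting on $U$ and on $W$ by $\mathbb{R}$-linear automorphisms such that $g \circ \pi = \pi \circ g$ for all $g \in G$. Assume that $\ker \pi \subset U^G$, that $m := \dim \ker \pi \in \mathbb{N}$ (in particular $\ker\pi$ is finite dimensional), and let $d := \mathrm{rank}\, G^{ab}$ (assumed finite). Then \[ \dim \pi(U)^G/\pi(U^G) \le md . \] Moreover, let $\{u_1,\dots,u_m\}$ be a basis of $\ker \pi$ and let $\{g_1,\dots,g_d\}$ be a generating set of the free part of $G^{ab}$. If there exist $u_{j,k} \in \tilde{U}$ such that \[ (g_i - \mathrm{id}) u_{j,k} = \delta_{i,j} u_k \qquad \text{for } i,j = 1,\dots,d,\ k=1,\dots,m, \] then $\dim \pi(U)^G/\pi(U^G) = md$, and in addition, for any $w \in \pi(U)^G$ there exist $u \in U^G$ and real numbers $(a_{j,k})_{j=1,\dots,d,\,k=1,\dots,m}$ such that \[ w = \pi\Big(\sum_{j=1}^d \sum_{k=1}^m a_{j,k} u_{j,k} + u\Big), \] where the $a_{j,k}$ do not depend on the choice of the $u_{j,k}$ (they depend on $w$, the basis $\{u_1,\dots,u_m\}$ and the generating set $\{g_1,\dots,g_d\}$); that is, if $\tilde{u}_{j,k} \in \tilde{U}$ is any family with $(g_i-\mathrm{id})\tilde{u}_{j,k} = \delta_{i,j}u_k$ for all $i,j,k$, and $w = \pi(\sum_{j,k} \tilde{a}_{j,k}\tilde{u}_{j,k}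 + \tilde{u})$ with $\tilde{a}_{j,k} \in \mathbb{R}$ and $\tilde{u} \in U^G$, then $\tilde{a}_{j,k} = a_{j,k}$ for all $j,k$.
   Context: $U^G := \{u \in U : g(u) = u \ \forall g \in G\}$ and $W^G := \{w \in W : g(w) = w \ \forall g \in G\}$. $\pi(U)^G := \pi(U) \cap W^G$, and $\pi(U^G)$ is the image of $U^G$ under $\pi$; one has $\pi(U^G) \subset \pi(U)^G$. Dimensions are over $\mathbb{R}$. $\tilde{U} := \{u \in U : \pi(u) \in W^G\}$. $G^{ab}$ is the abelianization of $G$. When $\ker\pi \subset U^G$, the group $G^{ab}$ acts on $\tilde{U}$ by $[g]u := gu$, where $[g] \in G^{ab}$ is the class of $g \in G$ (this is well defined, i.e. $gu = hu$ for $u\in\tilde U$ whenever $[g]=[h]$); this is the action used in $(g_i - \mathrm{id})u_{j,k}$, with $\mathrm{id}$ the identity map. That $\{g_1,\dots,g_d\}$ generates the free part of $G^{ab}$ means that $G^{ab}$ is the direct sum of its torsion subgroup and the subgroup generated by $g_1,\dots,g_d$, the latter being free abelian of rank $d$. $\delta_{i,j}$ is the Kronecker delta. *)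

theory Defs
  imports
    Complex_Main
    "HOL-Library.Extended_Nat"
    "HOL-Algebra.Group_Action"
    "HOL-Algebra.Generated_Groups"
    "HOL-Algebra.Free_Abelian_Groups"
    "Jordan_Normal_Form.VS_Connect"
begin

section \<open>Quotients of real vector spaces\<close>

text \<open>
  The quotient \<open>V / S\<close> of a subspace \<open>V\<close> of a real vector space by a subspace \<open>S\<close> of \<open>V\<close>,
  as a vector space over \<open>class_ring\<close> (the field of reals, packaged as a record) in the sense of
  the locale \<open>vectorspace\<close>. Its elements are the cosets \<open>v + S\<close>. Adding \<open>S\<close> in the scalar
  multiplication matters only for the scalar \<open>0\<close>. The fields \<open>mult\<close> and \<open>one\<close> exist
  because module records extend ring records; they play no role.
\<close>

definition quotient_space :: "'a::real_vector set \<Rightarrow> 'a set \<Rightarrow> (real, 'a set) module" where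
  "quotient_space V S =
    \<lparr> carrier = (\<lambda>v. {v + s | s. s \<in> S}) ` V,
      mult = undefined, one = undefined,
      zero = S,
      add = (\<lambda>A B. {a + b | a b. a \<in> A \<and> b \<in> B}),
      smult = (\<lambda>c A. {c *\<^sub>R a + s | a s. a \<in> A \<and> s \<in> S}) \<rparr>"

context
  fixes V S :: "'a::real_vector set"
  assumes V: "Real_Vector_Spaces.subspace V" and S: "Real_Vector_Spaces.subspace S"
    and SV: "S \<subseteq> V"
begin

private abbreviation cs :: "'a \<Rightarrow> 'a set" where "cs v \<equiv> {v + s | s. s \<in> S}"

lemma quotient_space_coset_iff: "x \<in> {v + s | s. s \<in> S} \<longleftrightarrow> x - v \<in> S"
  by (auto intro: exI[of _ "x - v"])

lemma quotient_space_coset_eq_iff: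
  "{v + s | s. s \<in> S} = {w + s | s. s \<in> S} \<longleftrightarrow> v - w \<in> S"
proof
  assume "cs v = cs w"
  moreover have "v \<in> cs v" using real_vector.subspace_0[OF S] by force
  ultimately show "v - w \<in> S" using quotient_space_coset_iff by blast
next
  assume vw: "v - w \<in> S"
  have "x - v \<in> S \<longleftrightarrow> x - w \<in> S" for x
    using real_vector.subspace_add[OF S _ vw, of "x - v"]
      real_vector.subspace_diff[OF S _ vw, of "x - w"] by auto
  then show "cs v = cs w" using quotient_space_coset_iff by blast
qed

lemma quotient_space_zero: "\<zero>\<^bsub>quotient_space V S\<^esub> = {0 + s | s. s \<in> S}"
  by (simp add: quotient_space_def)

lemma quotient_space_add:
  "{v + s | s. s \<in> S} \<oplus>\<^bsub>quotient_space V S\<^esub> {w + s | s. s \<in> S} = {(v + w) + s | s. s \<in> S}"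
proof -
  have "{a + b | a b. a \<in> cs v \<and> b \<in> cs w} = cs (v + w)"
  proof (intro equalityI subsetI)
    fix x assume "x \<in> {a + b | a b. a \<in> cs v \<and> b \<in> cs w}"
    then obtain s t where st: "s \<in> S" "t \<in> S" "x = (v + s) + (w + t)" by blast
    then have "x = (v + w) + (s + t)" by simp
    with real_vector.subspace_add[OF S st(1,2)] show "x \<in> cs (v + w)" by blast
  next
    fix x assume "x \<in> cs (v + w)"
    then obtain s where s: "s \<in> S" "x = (v + s) + (w + 0)" by auto
    with real_vector.subspace_0[OF S] show "x \<in> {a + b | a b. a \<in> cs v \<and> b \<in> cs w}" by blast
  qed
  then show ?thesis by (simp add: quotient_space_def)
qed

lemma quotient_space_smult:
  "c \<odot>\<^bsub>quotient_space V S\<^esub> {v + s | s. s \<in> S} = {c *\<^sub>R v + s | s. s \<in> S}"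
proof -
  have "{c *\<^sub>R a + s | a s. a \<in> cs v \<and> s \<in> S} = cs (c *\<^sub>R v)"
  proof (intro equalityI subsetI)
    fix x assume "x \<in> {c *\<^sub>R a + s | a s. a \<in> cs v \<and> s \<in> S}"
    then obtain s t where st: "s \<in> S" "t \<in> S" "x = c *\<^sub>R (v + s) + t" by blast
    then have "x = c *\<^sub>R v + (c *\<^sub>R s + t)" by (simp add: scaleR_right_distrib)
    with real_vector.subspace_add[OF S real_vector.subspace_scale[OF S st(1)] st(2)]
    show "x \<in> cs (c *\<^sub>R v)" by blast
  next
    fix x assume "x \<in> cs (c *\<^sub>R v)"
    then obtain s where s: "s \<in> S" "x = c *\<^sub>R (v + 0) + s" by auto
    with real_vector.subspace_0[OF S]
    show "x \<in> {c *\<^sub>R a + s | a s. a \<in> cs v \<and> s \<in> S}" by blast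
  qed
  then show ?thesis by (simp add: quotient_space_def)
qed

lemma vectorspace_quotient_space: "vectorspace class_ring (quotient_space V S)"
proof -
  let ?Q = "quotient_space V S"
  have car: "x \<in> carrier ?Q \<longleftrightarrow> (\<exists>v\<in>V. x = cs v)" for x
    by (auto simp: quotient_space_def)
  have carE: thesis if "x \<in> carrier ?Q" "\<And>v. v \<in> V \<Longrightarrow> x = cs v \<Longrightarrow> thesis" for x thesis
    using that(1) unfolding car by (elim bexE) (rule that(2))
  have carI: "cs v \<in> carrier ?Q" if "v \<in> V" for v
    unfolding car using that by (intro bexI[of _ v] refl)
  note ops = quotient_space_add quotient_space_smult quotient_space_zero
  note V0 = real_vector.subspace_0[OF V] and Va = real_vector.subspace_add[OF V]
    and Vs = real_vector.subspace_scale[OF V] and Vn = real_vector.subspace_neg[OF V]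
  have "abelian_group ?Q"
  proof (rule abelian_groupI)
    fix x y z
    assume x: "x \<in> carrier ?Q" and y: "y \<in> carrier ?Q"
    obtain a where a: "a \<in> V" "x = cs a" by (rule carE[OF x])
    obtain b where b: "b \<in> V" "y = cs b" by (rule carE[OF y])
    show "x \<oplus>\<^bsub>?Q\<^esub> y \<in> carrier ?Q" unfolding a(2) b(2) ops by (intro carI Va a b)
    show "x \<oplus>\<^bsub>?Q\<^esub> y = y \<oplus>\<^bsub>?Q\<^esub> x" unfolding a(2) b(2) ops by (simp add: add.commute)
    assume z: "z \<in> carrier ?Q"
    obtain c where c: "c \<in> V" "z = cs c" by (rule carE[OF z])
    show "(x \<oplus>\<^bsub>?Q\<^esub> y) \<oplus>\<^bsub>?Q\<^esub> z = x \<oplus>\<^bsub>?Q\<^esub> (y \<oplus>\<^bsub>?Q\<^esub> z)"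
      unfolding a(2) b(2) c(2) ops by (simp add: add.assoc)
  next
    show "\<zero>\<^bsub>?Q\<^esub> \<in> carrier ?Q" unfolding ops by (intro carI V0)
  next
    fix x assume x: "x \<in> carrier ?Q"
    obtain a where a: "a \<in> V" "x = cs a" by (rule carE[OF x])
    show "\<zero>\<^bsub>?Q\<^esub> \<oplus>\<^bsub>?Q\<^esub> x = x" unfolding a(2) ops by simp
    have "cs (- a) \<oplus>\<^bsub>?Q\<^esub> x = \<zero>\<^bsub>?Q\<^esub>" unfolding a(2) ops by simp
    moreover have "cs (- a) \<in> carrier ?Q" by (intro carI Vn a)
    ultimately show "\<exists>y\<in>carrier ?Q. y \<oplus>\<^bsub>?Q\<^esub> x = \<zero>\<^bsub>?Q\<^esub>" by blast
  qed
  moreover have "field (class_ring :: real ring)" by (rule class_field.field_axioms)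
  ultimately have "module class_ring ?Q"
  proof (intro module.intro module_axioms.intro)
    show "cring (class_ring :: real ring)" by (rule class_cring.is_cring)
  next
    fix a :: real and x assume x: "x \<in> carrier ?Q"
    obtain v where v: "v \<in> V" "x = cs v" by (rule carE[OF x])
    show "a \<odot>\<^bsub>?Q\<^esub> x \<in> carrier ?Q" unfolding v(2) ops by (intro carI Vs v)
  next
    fix a b :: real and x assume x: "x \<in> carrier ?Q"
    obtain v where v: "v \<in> V" "x = cs v" by (rule carE[OF x])
    show "(a \<oplus>\<^bsub>class_ring\<^esub> b) \<odot>\<^bsub>?Q\<^esub> x = a \<odot>\<^bsub>?Q\<^esub> x \<oplus>\<^bsub>?Q\<^esub> b \<odot>\<^bsub>?Q\<^esub> x"
      unfolding v(2) ops by (simp add: scaleR_left_distrib)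
    show "(a \<otimes>\<^bsub>class_ring\<^esub> b) \<odot>\<^bsub>?Q\<^esub> x = a \<odot>\<^bsub>?Q\<^esub> (b \<odot>\<^bsub>?Q\<^esub> x)"
      unfolding v(2) ops by simp
  next
    fix a :: real and x y assume x: "x \<in> carrier ?Q" and y: "y \<in> carrier ?Q"
    obtain v where v: "v \<in> V" "x = cs v" by (rule carE[OF x])
    obtain w where w: "w \<in> V" "y = cs w" by (rule carE[OF y])
    show "a \<odot>\<^bsub>?Q\<^esub> (x \<oplus>\<^bsub>?Q\<^esub> y) = a \<odot>\<^bsub>?Q\<^esub> x \<oplus>\<^bsub>?Q\<^esub> a \<odot>\<^bsub>?Q\<^esub> y"
      unfolding v(2) w(2) ops by (simp add: scaleR_right_distrib)
  next
    fix x assume x: "x \<in> carrier ?Q"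
    obtain v where v: "v \<in> V" "x = cs v" by (rule carE[OF x])
    show "\<one>\<^bsub>class_ring\<^esub> \<odot>\<^bsub>?Q\<^esub> x = x" unfolding v(2) ops by simp
  qed auto
  then show ?thesis
    by (intro vectorspace.intro class_field.field_axioms)
qed

end


section \<open>Abelian groups\<close>

definition abelianization :: "('g, 'b) monoid_scheme \<Rightarrow> 'g set monoid" where
  "abelianization G = G Mod derived G (carrier G)"

definition Z_independent :: "('a, 'b) monoid_scheme \<Rightarrow> 'a set \<Rightarrow> bool" where
  "Z_independent A S \<longleftrightarrow> finite S \<and> S \<subseteq> carrier A \<and>
    (\<forall>c :: 'a \<Rightarrow> int. finprod A (\<lambda>x. x [^]\<^bsub>A\<^esub> c x) S = \<one>\<^bsub>A\<^esub> \<longrightarrow> (\<forall>x\<in>S. c x = 0))"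

text \<open>
  The (torsion-free) rank of an abelian group: the supremum of the sizes of its finite
  \<open>\<int>\<close>-linearly independent subsets. The group need not be finitely generated.
\<close>

definition ab_rank :: "('a, 'b) monoid_scheme \<Rightarrow> enat" where
  "ab_rank A = (SUP S\<in>Collect (Z_independent A). enat (card S))"

definition torsion_part :: "('a, 'b) monoid_scheme \<Rightarrow> 'a set" where
  "torsion_part A = {x \<in> carrier A. \<exists>n::nat. n > 0 \<and> x [^]\<^bsub>A\<^esub> n = \<one>\<^bsub>A\<^esub>}"

definition generates_free_part ::
  "('a, 'b) monoid_scheme \<Rightarrow> nat \<Rightarrow> (nat \<Rightarrow> 'a) \<Rightarrow> bool" where
  "generates_free_part A d g \<longleftrightarrow>
    g ` {1..d} \<subseteq> carrier A \<and>
    torsion_part A \<inter> generate A (g ` {1..d}) = {\<one>\<^bsub>A\<^esub>} \<and>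
    torsion_part A <#>\<^bsub>A\<^esub> generate A (g ` {1..d}) = carrier A \<and>
    A\<lparr>carrier := generate A (g ` {1..d})\<rparr> \<cong> free_Abelian_group {1..d}"


section \<open>Invariants of linear group actions\<close>

definition fixed_points :: "('g, 'b) monoid_scheme \<Rightarrow> ('g \<Rightarrow> 'a \<Rightarrow> 'a) \<Rightarrow> 'a set" where
  "fixed_points G \<phi> = {x. \<forall>g\<in>carrier G. \<phi> g x = x}"

definition linear_action ::
  "('g, 'b) monoid_scheme \<Rightarrow> ('g \<Rightarrow> 'a::real_vector \<Rightarrow> 'a) \<Rightarrow> bool" where
  "linear_action G \<phi> \<longleftrightarrow> group_action G UNIV \<phi> \<and> (\<forall>g\<in>carrier G. linear (\<phi> g))"

definition U_tilde ::
  "('g, 'b) monoid_scheme \<Rightarrow> ('g \<Rightarrow> 'w \<Rightarrow> 'w) \<Rightarrow> ('u \<Rightarrow> 'w) \<Rightarrow> 'u set" where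
  "U_tilde G \<psi> \<pi> = {u. \<pi> u \<in> fixed_points G \<psi>}"

definition invariants_quotient ::
  "('g, 'b) monoid_scheme \<Rightarrow> ('g \<Rightarrow> 'u \<Rightarrow> 'u) \<Rightarrow> ('g \<Rightarrow> 'w \<Rightarrow> 'w) \<Rightarrow>
    ('u \<Rightarrow> 'w::real_vector) \<Rightarrow> (real, 'w set) module" where
  "invariants_quotient G \<phi> \<psi> \<pi> =
    quotient_space (range \<pi> \<inter> fixed_points G \<psi>) (\<pi> ` fixed_points G \<phi>)"

lemma subspace_fixed_points:
  assumes "linear_action G \<phi>"
  shows "Real_Vector_Spaces.subspace (fixed_points G \<phi>)"
  using assms
  by (auto simp: linear_action_def fixed_points_def real_vector.subspace_def
      linear_0 linear_add linear_cmul)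

lemma vectorspace_invariants_quotient:
  assumes \<phi>: "linear_action G \<phi>" and \<psi>: "linear_action G \<psi>" and \<pi>: "linear \<pi>"
    and equiv: "\<And>g u. g \<in> carrier G \<Longrightarrow> \<psi> g (\<pi> u) = \<pi> (\<phi> g u)"
  shows "vectorspace class_ring (invariants_quotient G \<phi> \<psi> \<pi>)"
  unfolding invariants_quotient_def
proof (rule vectorspace_quotient_space)
  show "Real_Vector_Spaces.subspace (range \<pi> \<inter> fixed_points G \<psi>)"
    using linear_subspace_image[OF \<pi> real_vector.subspace_UNIV] subspace_fixed_points[OF \<psi>]
    by (rule real_vector.subspace_inter)
  show "Real_Vector_Spaces.subspace (\<pi> ` fixed_points G \<phi>)"
    by (rule linear_subspace_image[OF \<pi> subspace_fixed_points[OF \<phi>]])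
  show "\<pi> ` fixed_points G \<phi> \<subseteq> range \<pi> \<inter> fixed_points G \<psi>"
    by (auto simp: fixed_points_def equiv)
qed

text \<open>
  The action of an element \<open>C\<close> of the abelianization (a coset of the derived subgroup) on
  \<open>U_tilde\<close>: the common value of \<open>\<phi> g u\<close> for the representatives \<open>g\<close> of \<open>C\<close>.
  That there is a common value is the lemma \<open>ab_action_class\<close> below.
\<close>

definition ab_action :: "('g \<Rightarrow> 'u \<Rightarrow> 'u) \<Rightarrow> 'g set \<Rightarrow> 'u \<Rightarrow> 'u" where
  "ab_action \<phi> C u = (THE v. \<forall>g\<in>C. \<phi> g u = v)"

lemma linear_action_mult:
  assumes "linear_action G \<phi>" "g \<in> carrier G" "h \<in> carrier G"
  shows "\<phi> (g \<otimes>\<^bsub>G\<^esub> h) u = \<phi> g (\<phi> h u)"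
  using assms group_action.composition_rule[of G UNIV \<phi> u g h]
  by (simp add: linear_action_def)

lemma ab_action_class:
  assumes act: "linear_action G \<phi>"
    and \<pi>: "linear \<pi>"
    and equiv: "\<And>g u. g \<in> carrier G \<Longrightarrow> \<pi> (\<phi> g u) = \<psi> g (\<pi> u)"
    and ker: "{u. \<pi> u = 0} \<subseteq> fixed_points G \<phi>"
    and u: "u \<in> U_tilde G \<psi> \<pi>"
    and g: "g \<in> carrier G"
  shows "ab_action \<phi> (derived G (carrier G) #>\<^bsub>G\<^esub> g) u = \<phi> g u"
proof -
  have ga: "group_action G UNIV \<phi>" using act by (simp add: linear_action_def)
  interpret group G using ga by (simp add: group_action_def group_hom_def)
  note mult = linear_action_mult[OF act]
  have lin: "linear (\<phi> x)" if "x \<in> carrier G" for x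
    using act that by (simp add: linear_action_def)
  define k where "k x = \<phi> x u - u" for x
  have kfix: "\<phi> y (k x) = k x" if "x \<in> carrier G" "y \<in> carrier G" for x y
  proof -
    have "\<pi> (k x) = 0"
      using u that(1) equiv[OF that(1)]
      by (simp add: k_def linear_diff[OF \<pi>] U_tilde_def fixed_points_def)
    then show ?thesis using ker that(2) by (auto simp: fixed_points_def)
  qed
  have k_mult: "k (x \<otimes>\<^bsub>G\<^esub> y) = k x + k y" if "x \<in> carrier G" "y \<in> carrier G" for x y
  proof -
    have "\<phi> x (\<phi> y u) = \<phi> x (u + k y)" by (simp add: k_def)
    also have "\<dots> = \<phi> x u + k y"
      using linear_add[OF lin[OF that(1)]] kfix[OF that(2,1)] by simp
    finally show ?thesis using that by (simp add: k_def mult)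
  qed
  have k_one: "k \<one>\<^bsub>G\<^esub> = 0" using k_mult[of "\<one>\<^bsub>G\<^esub>" "\<one>\<^bsub>G\<^esub>"] by simp
  have k_inv: "k (inv\<^bsub>G\<^esub> x) = - k x" if "x \<in> carrier G" for x
    using k_mult[of x "inv\<^bsub>G\<^esub> x"] that k_one by (simp add: eq_neg_iff_add_eq_0 add.commute)
  have sub: "subgroup {x \<in> carrier G. k x = 0} G"
    by (rule subgroupI) (use k_one in \<open>auto simp: k_mult k_inv\<close>)
  have "derived G (carrier G) \<subseteq> {x \<in> carrier G. k x = 0}"
    unfolding derived_def
    by (rule generate_subgroup_incl[OF _ sub]) (auto simp: k_mult k_inv)
  then have D: "k n = 0" "n \<in> carrier G" if "n \<in> derived G (carrier G)" for n
    using that by auto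
  let ?C = "derived G (carrier G) #>\<^bsub>G\<^esub> g"
  have all: "\<phi> h u = \<phi> g u" if "h \<in> ?C" for h
  proof -
    obtain n where n: "n \<in> derived G (carrier G)" "h = n \<otimes>\<^bsub>G\<^esub> g"
      using \<open>h \<in> ?C\<close> by (auto simp: r_coset_def)
    then have "k h = k g" using k_mult[OF D(2) g] D(1) by simp
    then show ?thesis by (simp add: k_def)
  qed
  have "\<one>\<^bsub>G\<^esub> \<in> derived G (carrier G)" by (simp add: derived_def generate.one)
  then have "\<one>\<^bsub>G\<^esub> \<otimes>\<^bsub>G\<^esub> g \<in> ?C" unfolding r_coset_def by blast
  then have "?C \<noteq> {}" by blast
  then show ?thesis unfolding ab_action_def
    by (intro the_equality) (use all in auto)
qed

text \<open>
  The conditions \<open>(g\<^sub>i - id) u\<^sub>j\<^sub>k = \<delta>\<^sub>i\<^sub>j u\<^sub>k\<close> on a family of vectors in \<open>U_tilde\<close>,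
  with \<open>g\<close> a family of elements of the abelianization.
\<close>

definition dual_family ::
  "('g, 'b) monoid_scheme \<Rightarrow> ('g \<Rightarrow> 'u \<Rightarrow> 'u) \<Rightarrow> ('g \<Rightarrow> 'w \<Rightarrow> 'w) \<Rightarrow> ('u::real_vector \<Rightarrow> 'w) \<Rightarrow>
    nat \<Rightarrow> nat \<Rightarrow> (nat \<Rightarrow> 'g set) \<Rightarrow> (nat \<Rightarrow> 'u) \<Rightarrow> (nat \<Rightarrow> nat \<Rightarrow> 'u) \<Rightarrow> bool" where
  "dual_family G \<phi> \<psi> \<pi> d m g b v \<longleftrightarrow>
    (\<forall>j\<in>{1..d}. \<forall>k\<in>{1..m}. v j k \<in> U_tilde G \<psi> \<pi>) \<and>
    (\<forall>i\<in>{1..d}. \<forall>j\<in>{1..d}. \<forall>k\<in>{1..m}.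
      ab_action \<phi> (g i) (v j k) - v j k = (if i = j then b k else 0))"

end

theory Submission
  imports Defs
begin

text \<open>
  An element \<open>w\<close> of \<open>\<pi>(U)\<^sup>G\<close> is \<open>\<pi> u\<close> for some \<open>u\<close> in \<open>U_tilde\<close>, and the obstruction to choosing
  \<open>u\<close> invariant is the map \<open>g \<mapsto> g u - u\<close>. Its values lie in \<open>ker \<pi>\<close>, on which \<open>G\<close> acts
  trivially, so it is a homomorphism from \<open>G\<close> to the vector space \<open>ker \<pi>\<close> and factors through
  the abelianization (\<open>additive_cocycle\<close>). It vanishes exactly when \<open>u\<close> is invariant, and it
  does not change when \<open>u\<close> is replaced by another lift of \<open>w\<close> (\<open>cocycle_eqI\<close>). Hence the
  quotient \<open>\<pi>(U)\<^sup>G / \<pi>(U\<^sup>G)\<close> embeds into \<open>Hom(G\<^sup>a\<^sup>b, ker \<pi>)\<close>.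

  A homomorphism into a real vector space kills torsion, and is determined by its values on a
  \<open>\<int>\<close>-independent set of maximum size \<open>d\<close>. Composing these values with the \<open>m\<close> coordinates of
  \<open>ker \<pi>\<close> gives \<open>m d\<close> linear functionals on \<open>U_tilde\<close> whose common kernel is \<open>U\<^sup>G\<close>, and this yields
  the bound. Functionals are used instead of the space of homomorphisms so that no dimension
  theory of function spaces is involved (\<open>complement_spanned_by_card_functionals\<close>).

  A homomorphism is also determined by its values on generators \<open>g\<^sub>i\<close> of the free part. For
  \<open>x = \<Sum> a\<^sub>j\<^sub>k v\<^sub>j\<^sub>k + u\<close> with a dual family \<open>v\<close> and \<open>u\<close> invariant, the value at \<open>g\<^sub>i\<close> is
  \<open>\<Sum>\<^sub>k a\<^sub>i\<^sub>k b\<^sub>k\<close>. So every homomorphism is realised, which makes the bound sharp, and the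
  coefficients are the coordinates of the obstruction of \<open>w\<close> at the \<open>g\<^sub>i\<close>: these mention
  neither the lift nor the dual family (\<open>coefficients_from_cocycle\<close>).
\<close>

section \<open>Additive maps on abelian groups\<close>

locale additive_map = comm_group A for A :: "('a, 'b) monoid_scheme" (structure) +
  fixes f :: "'a \<Rightarrow> 'v::real_vector"
  assumes f_mult: "\<And>x y. x \<in> carrier A \<Longrightarrow> y \<in> carrier A \<Longrightarrow> f (x \<otimes> y) = f x + f y"
begin

lemma f_one: "f \<one> = 0"
  using f_mult[of \<one> \<one>] by simp

lemma f_inv: "x \<in> carrier A \<Longrightarrow> f (inv x) = - f x"
  using f_mult[of x "inv x"] f_one by (simp add: eq_neg_iff_add_eq_0 add.commute)

lemma f_nat_pow: "x \<in> carrier A \<Longrightarrow> f (x [^] (n::nat)) = real n *\<^sub>R f x"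
  by (induction n) (simp_all add: f_one f_mult scaleR_left_distrib)

lemma f_int_pow: "x \<in> carrier A \<Longrightarrow> f (x [^] (c::int)) = real_of_int c *\<^sub>R f x"
  by (cases c rule: int_cases2) (simp_all add: int_pow_int int_pow_neg_int f_nat_pow f_inv)

lemma f_finprod:
  "finite S \<Longrightarrow> h \<in> S \<rightarrow> carrier A \<Longrightarrow> f (finprod A h S) = (\<Sum>x\<in>S. f (h x))"
proof (induction S rule: finite_induct)
  case empty
  show ?case by (simp add: f_one)
next
  case (insert x S)
  then have "h \<in> S \<rightarrow> carrier A" "h x \<in> carrier A" by auto
  with insert show ?case by (simp add: f_mult)
qed

text \<open>
  By maximality every further element \<open>y\<close> satisfies a relation with \<open>S\<close> in which its own
  exponent is nonzero. Applying \<open>f\<close> to it leaves a nonzero multiple of \<open>f y\<close>, and real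
  scalars can be cancelled.
\<close>

lemma vanishes_if_on_maximum_Z_independent:
  assumes S: "Z_independent A S" "\<And>T. Z_independent A T \<Longrightarrow> card T \<le> card S"
    and f0: "\<And>x. x \<in> S \<Longrightarrow> f x = 0" and y: "y \<in> carrier A"
  shows "f y = 0"
proof (cases "y \<in> S")
  case False
  have fin: "finite S" and sub: "S \<subseteq> carrier A" using S(1) by (auto simp: Z_independent_def)
  have "\<not> Z_independent A (insert y S)" using S(2)[of "insert y S"] False fin by auto
  then obtain c :: "'a \<Rightarrow> int" where
    prod: "finprod A (\<lambda>x. x [^] c x) (insert y S) = \<one>" and nz: "\<exists>x\<in>insert y S. c x \<noteq> 0"
    using fin sub y by (auto simp: Z_independent_def)
  have pi: "(\<lambda>x. x [^] c x) \<in> insert y S \<rightarrow> carrier A" using sub y by auto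
  have cy: "c y \<noteq> 0"
  proof
    assume "c y = 0"
    then have "finprod A (\<lambda>x. x [^] c x) S = \<one>"
      using prod finprod_insert[OF fin False, of "\<lambda>x. x [^] c x"] pi by (auto simp: Pi_iff)
    with S(1) nz \<open>c y = 0\<close> show False by (auto simp: Z_independent_def)
  qed
  have "0 = f (finprod A (\<lambda>x. x [^] c x) (insert y S))" by (simp add: prod f_one)
  also have "\<dots> = (\<Sum>x\<in>insert y S. real_of_int (c x) *\<^sub>R f x)"
    using fin pi sub y by (subst f_finprod) (auto intro!: sum.cong f_int_pow)
  also have "\<dots> = real_of_int (c y) *\<^sub>R f y" using fin False f0 by simp
  finally show ?thesis using cy by simp
qed (rule f0)

text \<open>
  Torsion is invisible to \<open>f\<close> because \<open>n f t = f (t\<^sup>n) = 0\<close> forces \<open>f t = 0\<close> over the reals.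
\<close>

lemma vanishes_if_on_free_part:
  assumes g: "generates_free_part A d g"
    and f0: "\<And>i. i \<in> {1..d} \<Longrightarrow> f (g i) = 0" and y: "y \<in> carrier A"
  shows "f y = 0"
proof -
  have sub: "g ` {1..d} \<subseteq> carrier A"
    using g unfolding generates_free_part_def by (rule conjunct1)
  have gen: "x \<in> carrier A \<and> f x = 0" if "x \<in> generate A (g ` {1..d})" for x
    using that
  proof (induction rule: generate.induct)
    case (incl h)
    then show ?case using sub f0 by blast
  next
    case (inv h)
    then obtain i where i: "i \<in> {1..d}" "h = g i" by blast
    then have "h \<in> carrier A" using sub by blast
    then show ?case using f0[OF i(1)] i(2) by (simp add: f_inv)
  next
    case one then show ?case by (simp add: f_one)
  next
    case (eng h1 h2) then show ?case by (simp add: f_mult)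
  qed
  have "torsion_part A <#> generate A (g ` {1..d}) = carrier A"
    using g unfolding generates_free_part_def by blast
  then have "y \<in> torsion_part A <#> generate A (g ` {1..d})" using y by blast
  then obtain t x where t: "t \<in> torsion_part A" and x: "x \<in> generate A (g ` {1..d})"
    and yt: "y = t \<otimes> x" by (auto simp: set_mult_def)
  obtain n :: nat where n: "n > 0" "t [^] n = \<one>" "t \<in> carrier A"
    using t by (auto simp: torsion_part_def)
  have "real n *\<^sub>R f t = 0" using f_nat_pow[OF n(3), of n] n(2) by (simp add: f_one)
  then have "f t = 0" using n(1) by simp
  moreover have "f (t \<otimes> x) = f t + f x" using f_mult[OF n(3)] gen[OF x] by blast
  ultimately show ?thesis using gen[OF x] yt by simp
qed

end

text \<open>
  A finite supremum of natural numbers is attained, so the rank is the size of an actual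
  independent set.
\<close>

lemma maximum_Z_independent_exists:
  assumes "ab_rank A = enat d"
  obtains S where "Z_independent A S" "card S = d" "\<And>T. Z_independent A T \<Longrightarrow> card T \<le> d"
proof -
  have le: "card T \<le> d" if "Z_independent A T" for T
  proof -
    have "enat (card T) \<le> ab_rank A" unfolding ab_rank_def by (rule SUP_upper) (use that in simp)
    then show ?thesis using assms by simp
  qed
  have "Z_independent A {}" by (simp add: Z_independent_def)
  have "\<exists>S. Z_independent A S \<and> card S = d"
  proof (rule ccontr)
    assume no: "\<nexists>S. Z_independent A S \<and> card S = d"
    then have d: "d > 0" using \<open>Z_independent A {}\<close> by (cases d) auto
    have "ab_rank A \<le> enat (d - 1)" unfolding ab_rank_def
    proof (rule SUP_least)
      fix T assume "T \<in> Collect (Z_independent A)"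
      then have "card T \<le> d" "card T \<noteq> d" using le no by auto
      then show "enat (card T) \<le> enat (d - 1)" by simp
    qed
    then show False using assms d by simp
  qed
  then show thesis using that le by blast
qed

section \<open>Dimensions of quotient spaces\<close>

text \<open>
  Induction on the number of functionals: either the new functional is zero on \<open>V\<close>, or
  \<open>V\<close> is spanned by its kernel in \<open>V\<close> and one vector outside it. The functionals need
  to be linear only on \<open>V\<close>, because the class of an element of the abelianization acts
  linearly only there.
\<close>

lemma complement_spanned_by_card_functionals:
  fixes f :: "'i \<Rightarrow> 'a::real_vector \<Rightarrow> real"
  assumes "finite I" "Real_Vector_Spaces.subspace V"
    and "\<And>i x y. i \<in> I \<Longrightarrow> x \<in> V \<Longrightarrow> y \<in> V \<Longrightarrow> f i (x + y) = f i x + f i y"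
    and "\<And>i c x. i \<in> I \<Longrightarrow> x \<in> V \<Longrightarrow> f i (c *\<^sub>R x) = c * f i x"
    and "\<And>v. v \<in> V \<Longrightarrow> (\<And>i. i \<in> I \<Longrightarrow> f i v = 0) \<Longrightarrow> v \<in> S"
  shows "\<exists>X \<subseteq> V. finite X \<and> card X \<le> card I \<and>
    (\<forall>v\<in>V. \<exists>y \<in> Real_Vector_Spaces.span X. v - y \<in> S)"
  using assms
proof (induction I arbitrary: V rule: finite_induct)
  case empty
  then show ?case by (intro exI[of _ "{}"]) auto
next
  case (insert i I)
  note V = insert.prems(1) and add = insert.prems(2) and sc = insert.prems(3)
    and ker = insert.prems(4)
  show ?case
  proof (cases "\<exists>v0\<in>V. f i v0 \<noteq> 0")
    case False
    have "\<exists>X \<subseteq> V. finite X \<and> card X \<le> card I \<and>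
        (\<forall>v\<in>V. \<exists>y \<in> Real_Vector_Spaces.span X. v - y \<in> S)"
    proof (rule insert.IH[OF V])
      fix v assume "v \<in> V" "\<And>i. i \<in> I \<Longrightarrow> f i v = 0"
      then show "v \<in> S" using False by (intro ker) auto
    qed (use add sc in auto)
    moreover have "card I \<le> card (insert i I)" using insert.hyps by simp
    ultimately show ?thesis by (meson le_trans)
  next
    case True
    then obtain v0 where v0: "v0 \<in> V" "f i v0 \<noteq> 0" by blast
    define V' where "V' = {v \<in> V. f i v = 0}"
    have f0: "f i 0 = 0" using sc[of i 0 0] real_vector.subspace_0[OF V] by simp
    have V': "Real_Vector_Spaces.subspace V'"
      using V f0 add sc unfolding V'_def real_vector.subspace_def by auto
    have "\<exists>X \<subseteq> V'. finite X \<and> card X \<le> card I \<and>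
        (\<forall>v\<in>V'. \<exists>y \<in> Real_Vector_Spaces.span X. v - y \<in> S)"
    proof (rule insert.IH[OF V'])
      fix v assume "v \<in> V'" "\<And>i. i \<in> I \<Longrightarrow> f i v = 0"
      then show "v \<in> S" by (intro ker) (auto simp: V'_def)
    qed (use add sc in \<open>auto simp: V'_def\<close>)
    then obtain X where X: "X \<subseteq> V'" "finite X" "card X \<le> card I"
      and sp: "\<And>v. v \<in> V' \<Longrightarrow> \<exists>y \<in> Real_Vector_Spaces.span X. v - y \<in> S" by blast
    have "\<exists>y \<in> Real_Vector_Spaces.span (insert v0 X). v - y \<in> S" if v: "v \<in> V" for v
    proof -
      define c where "c = f i v / f i v0"
      have mem: "(- c) *\<^sub>R v0 \<in> V" using real_vector.subspace_scale[OF V v0(1)] .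
      have "v + (- c) *\<^sub>R v0 \<in> V'"
        using real_vector.subspace_add[OF V v mem] add[OF _ v mem] sc[OF _ v0(1), of i "- c"] v0(2)
        by (simp add: V'_def c_def)
      then obtain y where y: "y \<in> Real_Vector_Spaces.span X" "v + (- c) *\<^sub>R v0 - y \<in> S"
        using sp by blast
      have "y \<in> Real_Vector_Spaces.span (insert v0 X)"
        using y(1) real_vector.span_mono[of X "insert v0 X"] by auto
      then have "c *\<^sub>R v0 + y \<in> Real_Vector_Spaces.span (insert v0 X)"
        by (intro real_vector.span_add real_vector.span_scale[OF real_vector.span_base]) auto
      moreover have "v - (c *\<^sub>R v0 + y) \<in> S" using y(2) by (simp add: algebra_simps)
      ultimately show ?thesis by blast
    qed
    moreover have "card (insert v0 X) \<le> card (insert i I)"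
      using X insert.hyps by (simp add: card_insert_if)
    ultimately show ?thesis using X v0 by (intro exI[of _ "insert v0 X"]) (auto simp: V'_def)
  qed
qed

context
  fixes V S :: "'a::real_vector set" and x :: "'i \<Rightarrow> 'a" and I :: "'i set"
  assumes V: "Real_Vector_Spaces.subspace V" and S: "Real_Vector_Spaces.subspace S"
    and SV: "S \<subseteq> V" and fin: "finite I" and xV: "x ` I \<subseteq> V"
begin

private abbreviation coset :: "'a \<Rightarrow> 'a set" where "coset v \<equiv> {v + s | s. s \<in> S}"
private abbreviation (input) Q where "Q \<equiv> quotient_space V S"

interpretation Q: vectorspace "class_ring :: real ring" "quotient_space V S"
  by (rule vectorspace_quotient_space[OF V S SV])

private lemmas Q_add = quotient_space_add[OF V S SV]
private lemmas Q_smult = quotient_space_smult[OF V S SV]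
private lemmas Q_zero = quotient_space_zero[OF V S SV]
private lemmas coset_eq_iff = quotient_space_coset_eq_iff[OF V S SV]

private lemma Q_carrier: "carrier Q = coset ` V"
  by (simp add: quotient_space_def)

private lemma cosets_carrier: "(coset \<circ> x) ` I \<subseteq> carrier Q"
  using xV by (auto simp: Q_carrier)

text \<open>
  The next two lemmas reduce the dimension of the quotient to statements about the family \<open>x\<close>
  in \<open>V\<close> modulo \<open>S\<close>, so that cosets do not occur elsewhere. The family is indexed because
  a dual family is.
\<close>

lemma quotient_space_dim_le_card:
  assumes spanning: "\<And>v. v \<in> V \<Longrightarrow> \<exists>c. v - (\<Sum>i\<in>I. c i *\<^sub>R x i) \<in> S"
  shows "Q.fin_dim \<and> Q.dim \<le> card I"
proof -
  let ?X = "(coset \<circ> x) ` I"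
  interpret N: submodule class_ring "Q.span ?X" "quotient_space V S"
    by (rule Q.span_is_submodule[OF cosets_carrier])
  have comb: "coset (\<Sum>i\<in>J. c i *\<^sub>R x i) \<in> Q.span ?X" if "J \<subseteq> I" for J and c :: "'i \<Rightarrow> real"
    using finite_subset[OF that fin] that
  proof (induction J rule: finite_induct)
    case empty
    then show ?case using N.zero_closed by (simp add: Q_zero)
  next
    case (insert j J)
    have "coset (x j) \<in> Q.span ?X"
      using insert.prems by (intro Q.span_mem[OF cosets_carrier]) auto
    then have "c j \<odot>\<^bsub>quotient_space V S\<^esub> coset (x j) \<in> Q.span ?X"
      by (intro N.smult_closed) auto
    then have "c j \<odot>\<^bsub>quotient_space V S\<^esub> coset (x j)
        \<oplus>\<^bsub>quotient_space V S\<^esub> coset (\<Sum>i\<in>J. c i *\<^sub>R x i) \<in> Q.span ?X"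
      using insert by (intro N.m_closed) auto
    with insert.hyps show ?case by (simp add: Q_smult Q_add)
  qed
  have "carrier Q \<subseteq> Q.span ?X"
  proof
    fix q assume "q \<in> carrier Q"
    then obtain v where v: "v \<in> V" "q = coset v" by (auto simp: Q_carrier)
    obtain c where "v - (\<Sum>i\<in>I. c i *\<^sub>R x i) \<in> S" using spanning[OF v(1)] by blast
    then have "q = coset (\<Sum>i\<in>I. c i *\<^sub>R x i)" using v(2) coset_eq_iff by blast
    then show "q \<in> Q.span ?X" using comb[of I c] by simp
  qed
  then have gen: "Q.gen_set ?X" using Q.span_is_subset2[OF cosets_carrier] by blast
  have "card ?X \<le> card I" by (rule card_image_le[OF fin])
  then show ?thesis
    using gen fin cosets_carrier Q.gen_ge_dim[OF _ cosets_carrier gen] unfolding Q.fin_dim_def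
    by (intro conjI exI[of _ ?X]) auto
qed

lemma quotient_space_card_le_dim:
  assumes fd: "Q.fin_dim"
    and indep: "\<And>c i. (\<Sum>i\<in>I. c i *\<^sub>R x i) \<in> S \<Longrightarrow> i \<in> I \<Longrightarrow> c i = 0"
  shows "card I \<le> Q.dim"
proof -
  let ?X = "(coset \<circ> x) ` I"
  have inj: "inj_on (coset \<circ> x) I"
  proof (rule inj_onI, rule ccontr)
    fix i j assume ij: "i \<in> I" "j \<in> I" "(coset \<circ> x) i = (coset \<circ> x) j" "i \<noteq> j"
    then have "x i - x j \<in> S" using coset_eq_iff[of "x i" "x j"] by simp
    \<comment> \<open>as a combination of the whole family, so that independence modulo \<open>S\<close> applies to it\<close>
    also have "x i - x j = (\<Sum>k\<in>I. (if k = i then 1 else if k = j then - 1 else 0) *\<^sub>R x k)"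
      using ij fin by (simp add: sum.remove[of I i] sum.remove[of "I - {i}" j])
    finally show False using indep[of _ i] ij(1) by fastforce
  qed
  have comb: "Q.lincomb a ((coset \<circ> x) ` J) = coset (\<Sum>i\<in>J. a (coset (x i)) *\<^sub>R x i)"
    if "J \<subseteq> I" for J and a :: "'a set \<Rightarrow> real"
    using finite_subset[OF that fin] that
  proof (induction J rule: finite_induct)
    case empty
    then show ?case by (simp add: Q_zero)
  next
    case (insert j J)
    have nin: "(coset \<circ> x) j \<notin> (coset \<circ> x) ` J"
    proof
      assume "(coset \<circ> x) j \<in> (coset \<circ> x) ` J"
      then obtain i where i: "i \<in> J" "(coset \<circ> x) j = (coset \<circ> x) i" by blast
      then have "j = i" using inj insert.prems by (intro inj_onD[OF inj i(2)]) auto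
      with i(1) insert.hyps(2) show False by simp
    qed
    have "Q.lincomb a (insert ((coset \<circ> x) j) ((coset \<circ> x) ` J)) =
        a (coset (x j)) \<odot>\<^bsub>quotient_space V S\<^esub> coset (x j)
          \<oplus>\<^bsub>quotient_space V S\<^esub> Q.lincomb a ((coset \<circ> x) ` J)"
      using cosets_carrier insert.prems insert.hyps(1) nin
      by (subst Q.lincomb_insert2) auto
    then show ?case using insert by (simp add: Q_smult Q_add)
  qed
  have "Q.lin_indpt ?X"
  proof (rule Q.finite_lin_indpt2[OF _ cosets_carrier])
    fix a :: "'a set \<Rightarrow> real" assume "Q.lincomb a ?X = \<zero>\<^bsub>quotient_space V S\<^esub>"
    then have "coset (\<Sum>i\<in>I. a (coset (x i)) *\<^sub>R x i) = coset 0"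
      using comb[of I a] by (simp add: Q_zero)
    then have "(\<Sum>i\<in>I. a (coset (x i)) *\<^sub>R x i) \<in> S" using coset_eq_iff by force
    then have "a (coset (x i)) = 0" if "i \<in> I" for i
      using indep[of "\<lambda>i. a (coset (x i))"] that by blast
    then show "\<forall>v\<in>?X. a v = \<zero>\<^bsub>class_ring\<^esub>" by simp
  qed (use fin in simp)
  then have "card ?X \<le> Q.dim" by (rule Q.li_le_dim(2)[OF fd cosets_carrier])
  with card_image[OF inj] show ?thesis by simp
qed

end

section \<open>The cocycle of a lifted invariant\<close>

locale fixed_kernel =
  fixes G :: "('g, 'x) monoid_scheme"
    and \<phi> :: "'g \<Rightarrow> 'u::real_vector \<Rightarrow> 'u"
    and \<psi> :: "'g \<Rightarrow> 'w::real_vector \<Rightarrow> 'w"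
    and \<pi> :: "'u \<Rightarrow> 'w"
  assumes action_U: "linear_action G \<phi>"
    and action_W: "linear_action G \<psi>"
    and linear_\<pi>: "linear \<pi>"
    and equivariant: "g \<in> carrier G \<Longrightarrow> \<pi> (\<phi> g u) = \<psi> g (\<pi> u)"
    and ker_fixed: "{u. \<pi> u = 0} \<subseteq> fixed_points G \<phi>"
begin

sublocale group G
  using action_U by (simp add: linear_action_def group_action_def group_hom_def)

abbreviation "A \<equiv> abelianization G"
abbreviation "lifts \<equiv> U_tilde G \<psi> \<pi>"
abbreviation "cls g \<equiv> derived G (carrier G) #>\<^bsub>G\<^esub> g"

text \<open>
  The obstruction \<open>g \<mapsto> g u - u\<close> to the invariance of \<open>u\<close>, as a function on the
  abelianization. It is meaningful for \<open>u\<close> in \<open>lifts\<close> only.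
\<close>

definition cocycle :: "'g set \<Rightarrow> 'u \<Rightarrow> 'u" where
  "cocycle C u = ab_action \<phi> C u - u"

lemma A_carrier: "carrier A = cls ` carrier G"
  by (simp add: abelianization_def carrier_FactGroup)

lemma A_mult:
  assumes "g \<in> carrier G" "h \<in> carrier G"
  shows "cls g \<otimes>\<^bsub>A\<^esub> cls h = cls (g \<otimes>\<^bsub>G\<^esub> h)"
  using normal.rcos_sum[OF derived_self_is_normal assms] by (simp add: abelianization_def)

lemma linear_\<phi>: "g \<in> carrier G \<Longrightarrow> linear (\<phi> g)"
  using action_U by (simp add: linear_action_def)

lemma cocycle_cls: "u \<in> lifts \<Longrightarrow> g \<in> carrier G \<Longrightarrow> cocycle (cls g) u = \<phi> g u - u"
  unfolding cocycle_def
  by (subst ab_action_class[OF action_U linear_\<pi> equivariant ker_fixed]) auto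

lemma subspace_lifts: "Real_Vector_Spaces.subspace lifts"
  using linear_subspace_vimage[OF linear_\<pi> subspace_fixed_points[OF action_W]]
  by (simp add: U_tilde_def vimage_def)

lemma fixed_points_subset_lifts: "fixed_points G \<phi> \<subseteq> lifts"
proof
  fix u assume u: "u \<in> fixed_points G \<phi>"
  have "\<psi> g (\<pi> u) = \<pi> u" if "g \<in> carrier G" for g
    using equivariant[OF that, of u] u that by (simp add: fixed_points_def)
  then show "u \<in> lifts" by (simp add: U_tilde_def fixed_points_def)
qed

lemma image_lifts: "\<pi> ` lifts = range \<pi> \<inter> fixed_points G \<psi>"
  by (auto simp: U_tilde_def)

lemma cocycle_add: "C \<in> carrier A \<Longrightarrow> u \<in> lifts \<Longrightarrow> v \<in> lifts \<Longrightarrow>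
    cocycle C (u + v) = cocycle C u + cocycle C v"
  using real_vector.subspace_add[OF subspace_lifts]
  by (auto simp: A_carrier cocycle_cls linear_add[OF linear_\<phi>])

lemma cocycle_scale: "C \<in> carrier A \<Longrightarrow> u \<in> lifts \<Longrightarrow> cocycle C (c *\<^sub>R u) = c *\<^sub>R cocycle C u"
  using real_vector.subspace_scale[OF subspace_lifts]
  by (auto simp: A_carrier cocycle_cls linear_cmul[OF linear_\<phi>] scaleR_diff_right)

lemma cocycle_sum:
  assumes "C \<in> carrier A" "\<And>i. i \<in> I \<Longrightarrow> u i \<in> lifts"
  shows "cocycle C (\<Sum>i\<in>I. u i) = (\<Sum>i\<in>I. cocycle C (u i))"
  using assms(2)
proof (induction I rule: infinite_finite_induct)
  case (insert i I)
  then show ?case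
    by (simp add: cocycle_add[OF assms(1)] real_vector.subspace_sum[OF subspace_lifts])
qed (use cocycle_scale[OF assms(1), of 0 0] real_vector.subspace_0[OF subspace_lifts] in auto)

lemma cocycle_fixed: "C \<in> carrier A \<Longrightarrow> u \<in> fixed_points G \<phi> \<Longrightarrow> cocycle C u = 0"
  using fixed_points_subset_lifts by (auto simp: A_carrier cocycle_cls fixed_points_def)

lemma cocycle_ker: "C \<in> carrier A \<Longrightarrow> u \<in> lifts \<Longrightarrow> \<pi> (cocycle C u) = 0"
  by (auto simp: A_carrier cocycle_cls linear_diff[OF linear_\<pi>] equivariant U_tilde_def
      fixed_points_def)

text \<open>
  Two lifts of the same vector differ by an element of \<open>ker \<pi>\<close>, which is invariant.
\<close>

lemma cocycle_eqI:
  assumes "C \<in> carrier A" "u \<in> lifts" "v \<in> lifts" "\<pi> u = \<pi> v"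
  shows "cocycle C u = cocycle C v"
proof -
  have "u - v \<in> fixed_points G \<phi>"
    using ker_fixed assms(4) by (auto simp: linear_diff[OF linear_\<pi>])
  then have "cocycle C (u - v) = 0" "u - v \<in> lifts"
    using cocycle_fixed assms(1) fixed_points_subset_lifts by auto
  then show ?thesis using cocycle_add[of C v "u - v"] assms by simp
qed

lemma fixed_if_cocycle_vanishes:
  assumes u: "u \<in> lifts" and 0: "\<And>C. C \<in> carrier A \<Longrightarrow> cocycle C u = 0"
  shows "u \<in> fixed_points G \<phi>"
proof -
  have "\<phi> g u = u" if "g \<in> carrier G" for g
    using 0[of "cls g"] cocycle_cls[OF u that] that by (simp add: A_carrier)
  then show ?thesis by (simp add: fixed_points_def)
qed

text \<open>
  The cocycle identity \<open>g h u - u = g (h u - u) + (g u - u)\<close> is additivity, since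
  \<open>h u - u\<close> lies in \<open>ker \<pi>\<close> and is therefore fixed by \<open>g\<close>.
\<close>

lemma additive_cocycle:
  assumes u: "u \<in> lifts"
  shows "additive_map A (\<lambda>C. cocycle C u)"
proof (intro additive_map.intro additive_map_axioms.intro)
  show "comm_group A" unfolding abelianization_def by (rule derived_quot_is_comm_group)
next
  fix C D assume "C \<in> carrier A" "D \<in> carrier A"
  then obtain g h where g: "g \<in> carrier G" "C = cls g" and h: "h \<in> carrier G" "D = cls h"
    by (auto simp: A_carrier)
  have "\<pi> (\<phi> h u - u) = 0" using cocycle_ker[OF _ u, of D] h u by (simp add: cocycle_cls A_carrier)
  then have "\<phi> g (\<phi> h u - u) = \<phi> h u - u" using ker_fixed g(1) by (auto simp: fixed_points_def)
  then have "\<phi> g (\<phi> h u) - \<phi> g u = \<phi> h u - u" by (simp add: linear_diff[OF linear_\<phi>[OF g(1)]])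
  then show "cocycle (C \<otimes>\<^bsub>A\<^esub> D) u = cocycle C u + cocycle D u"
    using g h u by (simp add: A_mult cocycle_cls linear_action_mult[OF action_U] algebra_simps)
qed

section \<open>The upper bound\<close>

lemma invariants_quotient_subspaces:
  "Real_Vector_Spaces.subspace (range \<pi> \<inter> fixed_points G \<psi>)"
  "Real_Vector_Spaces.subspace (\<pi> ` fixed_points G \<phi>)"
  "\<pi> ` fixed_points G \<phi> \<subseteq> range \<pi> \<inter> fixed_points G \<psi>"
  using linear_subspace_image[OF linear_\<pi>] subspace_lifts subspace_fixed_points[OF action_U]
    fixed_points_subset_lifts by (auto simp flip: image_lifts)

text \<open>
  The functionals are indexed by pairs of an element \<open>C\<close> of a maximum independent set of
  the abelianization and a basis vector \<open>b\<close> of \<open>ker \<pi>\<close>: the pair takes \<open>u\<close> to the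
  \<open>b\<close>-coordinate of \<open>cocycle C u\<close>.
\<close>

lemma dim_invariants_quotient_le:
  assumes ker_fin_dim: "\<exists>B. finite B \<and> Real_Vector_Spaces.span B = {u. \<pi> u = 0}"
    and rank: "ab_rank A = enat d"
  shows "vectorspace.fin_dim class_ring (invariants_quotient G \<phi> \<psi> \<pi>) \<and>
    vectorspace.dim class_ring (invariants_quotient G \<phi> \<psi> \<pi>)
      \<le> Real_Vector_Spaces.dim {u. \<pi> u = 0} * d"
proof -
  let ?K = "{u. \<pi> u = 0}"
  obtain B where B: "B \<subseteq> ?K" "Real_Vector_Spaces.independent B"
    "?K \<subseteq> Real_Vector_Spaces.span B" "card B = Real_Vector_Spaces.dim ?K"
    by (rule real_vector.basis_exists)
  have finB: "finite B"
    using ker_fin_dim B(1,2) real_vector.independent_span_bound by metis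
  obtain S where S: "Z_independent A S" "card S = d" "\<And>T. Z_independent A T \<Longrightarrow> card T \<le> d"
    using maximum_Z_independent_exists[OF rank] by blast
  have finS: "finite S" and SA: "S \<subseteq> carrier A" using S(1) by (auto simp: Z_independent_def)
  have "\<exists>p :: 'u \<Rightarrow> real. linear p \<and> (\<forall>b'\<in>B. p b' = (if b' = b then 1 else 0))" for b
    by (rule linear_independent_extend[OF B(2)])
  \<comment> \<open>coordinates on \<open>ker \<pi>\<close>, extended linearly to all of the ambient space\<close>
  then obtain p :: "'u \<Rightarrow> 'u \<Rightarrow> real" where p: "\<And>b. linear (p b)"
    "\<And>b b'. b' \<in> B \<Longrightarrow> p b b' = (if b' = b then 1 else 0)" by metis
  have coords: "y = 0" if y: "y \<in> ?K" "\<And>b. b \<in> B \<Longrightarrow> p b y = 0" for y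
  proof -
    obtain c where c: "y = (\<Sum>b\<in>B. c b *\<^sub>R b)"
      using y(1) B(3) real_vector.span_finite[OF finB] by auto
    have "c b = 0" if "b \<in> B" for b
    proof -
      have "p b y = (\<Sum>b'\<in>B. c b' * (if b' = b then 1 else 0))"
        by (simp add: c linear_sum[OF p(1)] linear_cmul[OF p(1)] p(2))
      then show ?thesis using y(2)[OF that] that finB
        by (simp add: if_distrib cong: if_cong)
    qed
    then show ?thesis by (simp add: c)
  qed
  have "\<exists>X \<subseteq> lifts. finite X \<and> card X \<le> card (S \<times> B) \<and>
      (\<forall>u\<in>lifts. \<exists>y \<in> Real_Vector_Spaces.span X. u - y \<in> fixed_points G \<phi>)"
  proof (rule complement_spanned_by_card_functionals[where f = "\<lambda>(C, b) u. p b (cocycle C u)"])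
    show "finite (S \<times> B)" using finS finB by simp
  next
    fix u assume u: "u \<in> lifts" and "\<And>i. i \<in> S \<times> B \<Longrightarrow> (\<lambda>(C, b) u. p b (cocycle C u)) i u = 0"
    then have z: "p b (cocycle C u) = 0" if "C \<in> S" "b \<in> B" for C b using that by fastforce
    interpret k: additive_map A "\<lambda>C. cocycle C u" by (rule additive_cocycle[OF u])
    have "cocycle C u = 0" if "C \<in> S" for C
      using that z SA cocycle_ker[OF _ u] by (intro coords) auto
    then have "cocycle C u = 0" if "C \<in> carrier A" for C
      using k.vanishes_if_on_maximum_Z_independent[OF S(1)] S(2,3) that by metis
    then show "u \<in> fixed_points G \<phi>" by (rule fixed_if_cocycle_vanishes[OF u])
  qed (use SA in \<open>auto simp: subspace_lifts cocycle_add cocycle_scale linear_add[OF p(1)]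
      linear_cmul[OF p(1)] subset_iff\<close>)
  then obtain X where X: "X \<subseteq> lifts" "finite X" "card X \<le> card (S \<times> B)"
    "\<And>u. u \<in> lifts \<Longrightarrow> \<exists>y \<in> Real_Vector_Spaces.span X. u - y \<in> fixed_points G \<phi>" by blast
  have "vectorspace.fin_dim class_ring (invariants_quotient G \<phi> \<psi> \<pi>) \<and>
    vectorspace.dim class_ring (invariants_quotient G \<phi> \<psi> \<pi>) \<le> card X"
    unfolding invariants_quotient_def
  proof (rule quotient_space_dim_le_card[OF invariants_quotient_subspaces X(2), of \<pi>])
    show "\<pi> ` X \<subseteq> range \<pi> \<inter> fixed_points G \<psi>" using X(1) by (auto simp flip: image_lifts)
  next
    fix w assume "w \<in> range \<pi> \<inter> fixed_points G \<psi>"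
    then obtain u where u: "u \<in> lifts" "w = \<pi> u" by (auto simp flip: image_lifts)
    obtain c where c: "u - (\<Sum>x\<in>X. c x *\<^sub>R x) \<in> fixed_points G \<phi>"
      using X(4)[OF u(1)] real_vector.span_finite[OF X(2)] by auto
    have "w - (\<Sum>x\<in>X. c x *\<^sub>R \<pi> x) = \<pi> (u - (\<Sum>x\<in>X. c x *\<^sub>R x))"
      by (simp add: u(2) linear_diff[OF linear_\<pi>] linear_sum[OF linear_\<pi>]
          linear_cmul[OF linear_\<pi>])
    with c show "\<exists>c. w - (\<Sum>x\<in>X. c x *\<^sub>R \<pi> x) \<in> \<pi> ` fixed_points G \<phi>" by blast
  qed
  moreover have "card (S \<times> B) = Real_Vector_Spaces.dim ?K * d"
    by (simp add: card_cartesian_product B(4) S(2))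
  ultimately show ?thesis using X(3) by linarith
qed

end

section \<open>Dual families\<close>

locale dual_setup = fixed_kernel G \<phi> \<psi> \<pi>
  for G :: "('g, 'x) monoid_scheme"
    and \<phi> :: "'g \<Rightarrow> 'u::real_vector \<Rightarrow> 'u"
    and \<psi> :: "'g \<Rightarrow> 'w::real_vector \<Rightarrow> 'w"
    and \<pi> :: "'u \<Rightarrow> 'w" +
  fixes d m :: nat and b :: "nat \<Rightarrow> 'u" and g :: "nat \<Rightarrow> 'g set"
  assumes inj_b: "inj_on b {1..m}"
    and indep_b: "Real_Vector_Spaces.independent (b ` {1..m})"
    and span_b: "Real_Vector_Spaces.span (b ` {1..m}) = {u. \<pi> u = 0}"
    and free_part: "generates_free_part A d g"
begin

abbreviation dual :: "(nat \<Rightarrow> nat \<Rightarrow> 'u) \<Rightarrow> bool" where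
  "dual v \<equiv> dual_family G \<phi> \<psi> \<pi> d m g b v"

abbreviation comb :: "(nat \<Rightarrow> nat \<Rightarrow> real) \<Rightarrow> (nat \<Rightarrow> nat \<Rightarrow> 'u) \<Rightarrow> 'u" where
  "comb a v \<equiv> \<Sum>j\<in>{1..d}. \<Sum>k\<in>{1..m}. a j k *\<^sub>R v j k"

lemma g_carrier: "i \<in> {1..d} \<Longrightarrow> g i \<in> carrier A"
  using free_part unfolding generates_free_part_def by blast

lemma b_coeffs_exist:
  assumes "\<pi> y = 0"
  shows "\<exists>c. y = (\<Sum>k\<in>{1..m}. c k *\<^sub>R b k)"
proof -
  have "y \<in> Real_Vector_Spaces.span (b ` {1..m})" using assms span_b by simp
  then obtain c where "y = (\<Sum>x\<in>b ` {1..m}. c x *\<^sub>R x)"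
    using real_vector.span_finite[of "b ` {1..m}"] by auto
  then have "y = (\<Sum>k\<in>{1..m}. c (b k) *\<^sub>R b k)"
    by (simp add: sum.reindex[OF inj_b] del: One_nat_def)
  then show ?thesis by (rule exI[of _ "\<lambda>k. c (b k)"])
qed

lemma b_coeffs_unique:
  assumes eq: "(\<Sum>k\<in>{1..m}. c k *\<^sub>R b k) = (\<Sum>k\<in>{1..m}. c' k *\<^sub>R b k)" and k: "k \<in> {1..m}"
  shows "c k = c' k"
proof -
  define h where "h x = c (inv_into {1..m} b x) - c' (inv_into {1..m} b x)" for x
  have hb: "h (b k) = c k - c' k" if "k \<in> {1..m}" for k
    using that inj_b by (simp add: h_def)
  have "(\<Sum>x\<in>b ` {1..m}. h x *\<^sub>R x) = (\<Sum>k\<in>{1..m}. (c k - c' k) *\<^sub>R b k)"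
    using hb by (simp add: sum.reindex[OF inj_b] del: One_nat_def)
  also have "\<dots> = 0" using eq by (simp add: scaleR_diff_left sum_subtractf)
  finally have "h (b k) = 0"
    using real_vector.independentD[OF indep_b _ order_refl, of h "b k"] k by simp
  then show ?thesis using hb[OF k] by simp
qed

lemma comb_in_lifts: "dual v \<Longrightarrow> comb a v \<in> lifts"
  by (intro real_vector.subspace_sum[OF subspace_lifts] real_vector.subspace_scale[OF subspace_lifts])
    (simp add: dual_family_def)

lemma cocycle_comb:
  assumes v: "dual v" and i: "i \<in> {1..d}"
  shows "cocycle (g i) (comb a v) = (\<Sum>k\<in>{1..m}. a i k *\<^sub>R b k)"
proof -
  have vU: "v j k \<in> lifts" if "j \<in> {1..d}" "k \<in> {1..m}" for j k
    using v that by (simp add: dual_family_def)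
  have kv: "cocycle (g i) (v j k) = (if i = j then b k else 0)"
    if "j \<in> {1..d}" "k \<in> {1..m}" for j k
    using v i that by (simp add: dual_family_def cocycle_def)
  have avU: "a j k *\<^sub>R v j k \<in> lifts" if "j \<in> {1..d}" "k \<in> {1..m}" for j k
    by (rule real_vector.subspace_scale[OF subspace_lifts vU[OF that]])
  have "cocycle (g i) (comb a v) = (\<Sum>j\<in>{1..d}. cocycle (g i) (\<Sum>k\<in>{1..m}. a j k *\<^sub>R v j k))"
    by (intro cocycle_sum g_carrier i real_vector.subspace_sum[OF subspace_lifts] avU)
  also have "\<dots> = (\<Sum>j\<in>{1..d}. \<Sum>k\<in>{1..m}. cocycle (g i) (a j k *\<^sub>R v j k))"
    by (intro sum.cong refl cocycle_sum g_carrier i avU)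
  also have "\<dots> = (\<Sum>j\<in>{1..d}. if i = j then \<Sum>k\<in>{1..m}. a i k *\<^sub>R b k else 0)"
    using g_carrier[OF i] vU kv by (intro sum.cong) (auto simp: cocycle_scale)
  also have "\<dots> = (\<Sum>k\<in>{1..m}. a i k *\<^sub>R b k)" using i by simp
  finally show ?thesis .
qed

text \<open>
  Matching the values of the cocycle at the generators \<open>g i\<close> is enough: the difference then
  has a cocycle that vanishes on the free part, hence everywhere.
\<close>

lemma decomposition_exists:
  assumes v: "dual v" and u: "u \<in> lifts"
  shows "\<exists>a. u - comb a v \<in> fixed_points G \<phi>"
proof -
  have "\<exists>c. i \<in> {1..d} \<longrightarrow> cocycle (g i) u = (\<Sum>k\<in>{1..m}. c k *\<^sub>R b k)" for i
    using b_coeffs_exist cocycle_ker[OF g_carrier u] by blast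
  then obtain a where a: "\<And>i. i \<in> {1..d} \<Longrightarrow> cocycle (g i) u = (\<Sum>k\<in>{1..m}. a i k *\<^sub>R b k)"
    by metis
  let ?u = "u - comb a v"
  have uU: "?u \<in> lifts" by (rule real_vector.subspace_diff[OF subspace_lifts u comb_in_lifts[OF v]])
  interpret k: additive_map A "\<lambda>C. cocycle C ?u" by (rule additive_cocycle[OF uU])
  have "cocycle (g i) ?u = 0" if "i \<in> {1..d}" for i
    using cocycle_add[OF g_carrier[OF that] uU comb_in_lifts[OF v, of a]] a[OF that]
      cocycle_comb[OF v that, of a] by simp
  then have "cocycle C ?u = 0" if "C \<in> carrier A" for C
    using k.vanishes_if_on_free_part[OF free_part _ that] by blast
  then have "?u \<in> fixed_points G \<phi>" by (rule fixed_if_cocycle_vanishes[OF uU])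
  then show ?thesis by blast
qed

text \<open>
  The right-hand side depends on neither \<open>v\<close> nor \<open>a\<close>, and by \<open>cocycle_eqI\<close> only on
  \<open>\<pi> x\<close>. This is the source of both uniqueness of the coefficients and independence of the
  vectors \<open>\<pi> (v j k)\<close> modulo \<open>\<pi> (fixed_points G \<phi>)\<close>.
\<close>

lemma coefficients_from_cocycle:
  assumes v: "dual v" and u: "u \<in> fixed_points G \<phi>" and x: "x \<in> lifts"
    and eq: "\<pi> x = \<pi> (comb a v + u)" and i: "i \<in> {1..d}"
  shows "(\<Sum>k\<in>{1..m}. a i k *\<^sub>R b k) = cocycle (g i) x"
proof -
  have uU: "u \<in> lifts" using u fixed_points_subset_lifts by blast
  have "cocycle (g i) x = cocycle (g i) (comb a v + u)"
    by (rule cocycle_eqI[OF g_carrier[OF i] x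
          real_vector.subspace_add[OF subspace_lifts comb_in_lifts[OF v] uU] eq])
  also have "\<dots> = cocycle (g i) (comb a v)"
    using cocycle_add[OF g_carrier[OF i] comb_in_lifts[OF v] uU] cocycle_fixed[OF g_carrier[OF i] u]
    by simp
  finally show ?thesis by (simp only: cocycle_comb[OF v i])
qed

lemma md_le_dim_invariants_quotient:
  assumes v: "dual v"
    and fd: "vectorspace.fin_dim class_ring (invariants_quotient G \<phi> \<psi> \<pi>)"
  shows "m * d \<le> vectorspace.dim class_ring (invariants_quotient G \<phi> \<psi> \<pi>)"
proof -
  let ?I = "{1..d} \<times> {1..m}" and ?x = "\<lambda>(j, k). \<pi> (v j k)"
  have "card ?I \<le> vectorspace.dim class_ring (invariants_quotient G \<phi> \<psi> \<pi>)"
    unfolding invariants_quotient_def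
  proof (rule quotient_space_card_le_dim[OF invariants_quotient_subspaces _ _ fd[unfolded invariants_quotient_def],
        where x = ?x])
    show "?x ` ?I \<subseteq> range \<pi> \<inter> fixed_points G \<psi>"
      using v by (auto simp: dual_family_def U_tilde_def)
  next
    fix c :: "nat \<times> nat \<Rightarrow> real" and i
    assume "(\<Sum>i\<in>?I. c i *\<^sub>R ?x i) \<in> \<pi> ` fixed_points G \<phi>" and i: "i \<in> ?I"
    then obtain u where u: "u \<in> fixed_points G \<phi>" "(\<Sum>i\<in>?I. c i *\<^sub>R ?x i) = \<pi> u" by blast
    obtain j k where jk: "i = (j, k)" "j \<in> {1..d}" "k \<in> {1..m}" using i by auto
    define a where "a j k = c (j, k)" for j k
    \<comment> \<open>so the image of \<open>comb a v\<close> is that of an invariant vector, whose cocycle is zero\<close>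
    have "(\<Sum>i\<in>?I. c i *\<^sub>R ?x i) = \<pi> (comb a v)"
      by (simp add: sum.cartesian_product linear_sum[OF linear_\<pi>] linear_cmul[OF linear_\<pi>]
          a_def case_prod_unfold)
    then have "\<pi> u = \<pi> (comb a v + 0)" using u(2) by simp
    moreover have "u \<in> lifts" "0 \<in> fixed_points G \<phi>"
      using u fixed_points_subset_lifts real_vector.subspace_0[OF subspace_fixed_points[OF action_U]]
      by auto
    ultimately have "(\<Sum>k\<in>{1..m}. a j k *\<^sub>R b k) = cocycle (g j) u"
      using coefficients_from_cocycle[OF v] jk(2) by blast
    also have "\<dots> = (\<Sum>k\<in>{1..m}. 0 *\<^sub>R b k)" using cocycle_fixed[OF g_carrier[OF jk(2)] u(1)] by simp
    finally show "c i = 0" using b_coeffs_unique[of "a j" "\<lambda>_. 0"] jk by (simp add: a_def)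
  qed simp
  then show ?thesis by (simp add: mult.commute)
qed

lemma unique_coefficients:
  assumes v: "dual v" and w: "w \<in> range \<pi> \<inter> fixed_points G \<psi>"
  shows "\<exists>a. (\<exists>u \<in> fixed_points G \<phi>. w = \<pi> (comb a v + u)) \<and>
    (\<forall>v' a'. \<forall>u' \<in> fixed_points G \<phi>. dual v' \<and> w = \<pi> (comb a' v' + u') \<longrightarrow>
      (\<forall>j\<in>{1..d}. \<forall>k\<in>{1..m}. a' j k = a j k))"
proof -
  obtain x where x: "x \<in> lifts" "w = \<pi> x" using w by (auto simp flip: image_lifts)
  obtain a where a: "x - comb a v \<in> fixed_points G \<phi>" using decomposition_exists[OF v x(1)] by blast
  have eq: "w = \<pi> (comb a v + (x - comb a v))" using x(2) by simp
  have "a' j k = a j k"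
    if "u' \<in> fixed_points G \<phi>" "dual v'" "w = \<pi> (comb a' v' + u')" "j \<in> {1..d}" "k \<in> {1..m}"
    for v' a' u' j k
  proof (rule b_coeffs_unique[OF _ that(5)])
    show "(\<Sum>k\<in>{1..m}. a' j k *\<^sub>R b k) = (\<Sum>k\<in>{1..m}. a j k *\<^sub>R b k)"
      using coefficients_from_cocycle[OF that(2,1) x(1) _ that(4)] that(3)
        coefficients_from_cocycle[OF v a x(1) _ that(4)] eq x(2) by simp
  qed
  then show ?thesis using a eq by (intro exI[of _ a]) blast
qed

end

theorem proposition1p2:
  fixes G :: "('g, 'x) monoid_scheme"
    and \<phi> :: "'g \<Rightarrow> 'u::real_vector \<Rightarrow> 'u"
    and \<psi> :: "'g \<Rightarrow> 'w::real_vector \<Rightarrow> 'w"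
    and \<pi> :: "'u \<Rightarrow> 'w"
    and m d :: nat
  assumes group: "group G"
    and action_U: "linear_action G \<phi>"
    and action_W: "linear_action G \<psi>"
    and linear_\<pi>: "linear \<pi>"
    and equivariant: "\<forall>g\<in>carrier G. \<forall>u. \<psi> g (\<pi> u) = \<pi> (\<phi> g u)"
    and ker_fixed: "{u. \<pi> u = 0} \<subseteq> fixed_points G \<phi>"
    and ker_fin_dim: "\<exists>B. finite B \<and> Real_Vector_Spaces.span B = {u. \<pi> u = 0}"
    and m_def: "m = Real_Vector_Spaces.dim {u. \<pi> u = 0}"
    and d_def: "ab_rank (abelianization G) = enat d"
  shows
    "vectorspace.fin_dim class_ring (invariants_quotient G \<phi> \<psi> \<pi>) \<and>
     vectorspace.dim class_ring (invariants_quotient G \<phi> \<psi> \<pi>) \<le> m * d \<and>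
     (\<forall>(b :: nat \<Rightarrow> 'u) (g :: nat \<Rightarrow> 'g set) (v :: nat \<Rightarrow> nat \<Rightarrow> 'u).
        inj_on b {1..m} \<and>
        Real_Vector_Spaces.independent (b ` {1..m}) \<and>
        Real_Vector_Spaces.span (b ` {1..m}) = {u. \<pi> u = 0} \<and>
        generates_free_part (abelianization G) d g \<and>
        dual_family G \<phi> \<psi> \<pi> d m g b v
        \<longrightarrow>
        vectorspace.dim class_ring (invariants_quotient G \<phi> \<psi> \<pi>) = m * d \<and>
        (\<forall>w \<in> range \<pi> \<inter> fixed_points G \<psi>.
           \<exists>(a :: nat \<Rightarrow> nat \<Rightarrow> real).
             (\<exists>u \<in> fixed_points G \<phi>.
                w = \<pi> ((\<Sum>j\<in>{1..d}. \<Sum>k\<in>{1..m}. a j k *\<^sub>R v j k) + u)) \<and>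
             (\<forall>(v' :: nat \<Rightarrow> nat \<Rightarrow> 'u) (a' :: nat \<Rightarrow> nat \<Rightarrow> real). \<forall>u' \<in> fixed_points G \<phi>.
                dual_family G \<phi> \<psi> \<pi> d m g b v' \<and>
                w = \<pi> ((\<Sum>j\<in>{1..d}. \<Sum>k\<in>{1..m}. a' j k *\<^sub>R v' j k) + u')
                \<longrightarrow> (\<forall>j\<in>{1..d}. \<forall>k\<in>{1..m}. a' j k = a j k))))"
proof -
  interpret fixed_kernel G \<phi> \<psi> \<pi>
    by (intro fixed_kernel.intro action_U action_W linear_\<pi> ker_fixed)
      (simp add: equivariant)
  note upper = dim_invariants_quotient_le[OF ker_fin_dim d_def, folded m_def]
  show ?thesis
  proof (intro conjI allI impI; (elim conjE)?)
    show "vectorspace.fin_dim class_ring (invariants_quotient G \<phi> \<psi> \<pi>)"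
      "vectorspace.dim class_ring (invariants_quotient G \<phi> \<psi> \<pi>) \<le> m * d"
      using upper by auto
  next
    fix b :: "nat \<Rightarrow> 'u" and g :: "nat \<Rightarrow> 'g set" and v :: "nat \<Rightarrow> nat \<Rightarrow> 'u"
    assume *: "inj_on b {1..m}" "Real_Vector_Spaces.independent (b ` {1..m})"
      "Real_Vector_Spaces.span (b ` {1..m}) = {u. \<pi> u = 0}"
      "generates_free_part (abelianization G) d g" and v: "dual_family G \<phi> \<psi> \<pi> d m g b v"
    interpret dual_setup G \<phi> \<psi> \<pi> d m b g by unfold_locales (use * in auto)
    show "vectorspace.dim class_ring (invariants_quotient G \<phi> \<psi> \<pi>) = m * d"
      using upper md_le_dim_invariants_quotient[OF v] by (intro antisym) auto
    show "\<forall>w \<in> range \<pi> \<inter> fixed_points G \<psi>.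
           \<exists>(a :: nat \<Rightarrow> nat \<Rightarrow> real).
             (\<exists>u \<in> fixed_points G \<phi>.
                w = \<pi> ((\<Sum>j\<in>{1..d}. \<Sum>k\<in>{1..m}. a j k *\<^sub>R v j k) + u)) \<and>
             (\<forall>(v' :: nat \<Rightarrow> nat \<Rightarrow> 'u) (a' :: nat \<Rightarrow> nat \<Rightarrow> real). \<forall>u' \<in> fixed_points G \<phi>.
                dual_family G \<phi> \<psi> \<pi> d m g b v' \<and>
                w = \<pi> ((\<Sum>j\<in>{1..d}. \<Sum>k\<in>{1..m}. a' j k *\<^sub>R v' j k) + u')
                \<longrightarrow> (\<forall>j\<in>{1..d}. \<forall>k\<in>{1..m}. a' j k = a j k))"
      using unique_coefficients[OF v] by blast
  qed
qed

end
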